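(* Let $G=(V,E)$ be either an adjacency graph, or a finite connected graph with a loop at each vertex. Let $f,u_0\colon V\to\mathbb{R}$ be functions, which are assumed to be continuous if $G$ is an adjacency graph. Assume $c_f=0$. Then the sequence $(u_n)$ of game values on $G$ with terminal payoff $u_0$ and running payoff $f$ is uniformly convergent on $V$.
   Context: A compact length space is a compact metric space $(V,d)$ such that for all $x,y\in V$ the distance $d(x,y)$ is the infimum of the lengths of rectifiable paths between $x$ and $y$. For $\epsilon>0$, the $\epsilon$-adjacency graph of $(V,d)$ has vertex set $V$, and two vertices $x,y$ are connected if and only if $d(x,y)\le\epsilon$ (so every vertex has a loop). An adjacency graph is an $\epsilon$-adjacency graph of some compact length space for some $\epsilon>0$. We write $x\sim y$ if $x,y$ are joined by an edge ($x\sim x$ if there is a loop at $x$). Game values: the sequence of game values with terminal payoff $u_0$ and running payoff $f$ is the sequence $(u_n)_{n\ge0}$ starting from $u_0$ with $$u_{n+1}(x)=\frac12\Big(\min_{y\sim x}u_n(y)+\max_{y\sim x}u_n(y)\Big)+f(x),\qquad x\in V,\ n\ge0$$ ($u_n$ is the value of the $n$-step random-turn tug-of-war game; on adjacency graphs with $f,u_0$ continuous all $u_n$ are continuous). Player I's long term advantage: for a bounded function $f$, $c_f$ is the (unique) real constant such that for every bounded $u_0\colon V\to\mathbb{R}$ the sequence of functions $(u_n-nc_f)$ is uniformly bounded, where $(u_n)$ are the game values with terminal payoff $u_0$ and running payoff $f$ (such a constant exists on every connected graph of finite diameter). *)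

theory Defs
  imports "HOL-Analysis.Analysis"
begin

section \<open>Compact length spaces\<close>

text \<open>
  The length of a path parametrised by the unit interval is the supremum, over all partitions
  \<open>0 = t 0 \<le> \<dots> \<le> t n = 1\<close>, of the sum of the distances between consecutive points.
\<close>

definition path_length :: "('a \<Rightarrow> 'a \<Rightarrow> real) \<Rightarrow> (real \<Rightarrow> 'a) \<Rightarrow> ennreal" where
  "path_length d g =
     (SUP (n, t) \<in> {(n, t). t 0 = 0 \<and> t n = 1 \<and> mono_on {..n} t}.
        \<Sum>i<n. ennreal (d (g (t i)) (g (t (Suc i)))))"

definition rectifiable_paths ::
    "'a set \<Rightarrow> ('a \<Rightarrow> 'a \<Rightarrow> real) \<Rightarrow> 'a \<Rightarrow> 'a \<Rightarrow> (real \<Rightarrow> 'a) set" where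
  "rectifiable_paths V d x y =
     {g. pathin (Metric_space.mtopology V d) g \<and> g 0 = x \<and> g 1 = y \<and> path_length d g < \<infinity>}"

text \<open>
  The infimum is taken in \<^typ>\<open>ennreal\<close>, where the infimum of the empty set is \<open>\<infinity>\<close>; hence the
  equation also says that any two points are joined by a rectifiable path.
\<close>

definition compact_length_space :: "'a set \<Rightarrow> ('a \<Rightarrow> 'a \<Rightarrow> real) \<Rightarrow> bool" where
  "compact_length_space V d \<longleftrightarrow>
     Metric_space V d \<and> compact_space (Metric_space.mtopology V d) \<and>
     (\<forall>x\<in>V. \<forall>y\<in>V. ennreal (d x y) = (INF g \<in> rectifiable_paths V d x y. path_length d g))"


section \<open>Graphs\<close>

text \<open>
  A graph is given by its vertex set and its adjacency relation, a symmetric set of ordered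
  pairs of vertices; a loop at \<open>x\<close> is the pair \<open>(x, x)\<close>.
\<close>

definition adjacency_edges :: "'a set \<Rightarrow> ('a \<Rightarrow> 'a \<Rightarrow> real) \<Rightarrow> real \<Rightarrow> ('a \<times> 'a) set" where
  "adjacency_edges V d \<epsilon> = {(x, y). x \<in> V \<and> y \<in> V \<and> d x y \<le> \<epsilon>}"

definition finite_connected_graph_with_loops :: "'a set \<Rightarrow> ('a \<times> 'a) set \<Rightarrow> bool" where
  "finite_connected_graph_with_loops V E \<longleftrightarrow>
     finite V \<and> E \<subseteq> V \<times> V \<and> sym E \<and> (\<forall>x\<in>V. \<forall>y\<in>V. (x, y) \<in> E\<^sup>*) \<and> (\<forall>x\<in>V. (x, x) \<in> E)"


section \<open>Game values and the long term advantage\<close>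

text \<open>
  Infimum and supremum replace minimum and maximum because the definition of the long term
  advantage quantifies over arbitrary bounded terminal payoffs, for which the extrema over the
  neighbours of a vertex need not be attained. On finite graphs, and for continuous payoffs on
  adjacency graphs, they are attained.
\<close>

primrec game_value ::
    "('a \<times> 'a) set \<Rightarrow> ('a \<Rightarrow> real) \<Rightarrow> ('a \<Rightarrow> real) \<Rightarrow> nat \<Rightarrow> 'a \<Rightarrow> real" where
  "game_value E f u0 0 = u0"
| "game_value E f u0 (Suc n) =
     (\<lambda>x. 1 / 2 * ((INF y \<in> E `` {x}. game_value E f u0 n y) +
                   (SUP y \<in> E `` {x}. game_value E f u0 n y)) + f x)"

text \<open>
  This is the constant written \<open>c\<^sub>f\<close>; it is meaningful for \<open>f\<close> bounded on a nonempty connected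
  graph of finite diameter, where it exists and is unique.
\<close>

definition long_term_advantage :: "'a set \<Rightarrow> ('a \<times> 'a) set \<Rightarrow> ('a \<Rightarrow> real) \<Rightarrow> real" where
  "long_term_advantage V E f =
     (THE c. \<forall>u0. bounded (u0 ` V) \<longrightarrow>
        (\<exists>B. \<forall>n. \<forall>x\<in>V. \<bar>game_value E f u0 n x - real n * c\<bar> \<le> B))"

end

theory Submission
  imports Defs "HOL-Complex_Analysis.Great_Picard"
begin

text \<open>
  One round of the game is a monotone operator commuting with the addition of constants, hence
  nonexpansive in the supremum norm, and \<open>c\<^sub>f = 0\<close> makes the game values uniformly bounded. It
  therefore suffices to find a subsequence converging uniformly to a fixed point.

  The increments \<open>u (n + 1) - u n\<close> tend to \<open>0\<close> uniformly: if they were frequently close to their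
  limiting supremum \<open>M > 0\<close>, then such an increment at \<open>x\<close> forces one of nearly the same size, one
  round earlier, at the minimising neighbour of \<open>x\<close>, where the value is lower by about \<open>M\<close>;
  going back many rounds contradicts boundedness.

  On an adjacency graph the same backward argument yields asymptotic equicontinuity. If \<open>x, x'\<close> have
  distance less than \<open>\<delta> \<le> \<epsilon>\<close> and nearly realise the limiting largest difference \<open>L\<close> of
  values over such pairs, then moving to the maximising neighbour of \<open>x\<close> and a matching neighbour
  of \<open>x'\<close> gives another such pair; since \<open>x\<close> itself is a neighbour of \<open>x'\<close>, the value at the
  first point has grown by about \<open>L\<close>. A diagonal argument then provides the subsequence.
\<close>

lemma bounded_image_real_iff:
  fixes h :: "'a \<Rightarrow> real"
  shows "bounded (h ` S) \<longleftrightarrow> (\<exists>B. \<forall>x\<in>S. \<bar>h x\<bar> \<le> B)"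
  by (simp add: bounded_iff)

section \<open>Drift backwards in time\<close>

text \<open>
  If \<open>L\<close> is the limiting supremum of \<open>g\<close>, each step backwards in time preserves the near-maximality
  of \<open>g\<close> up to a factor \<open>7\<close> in the error (large enough for both applications) and decreases \<open>\<phi>\<close> by
  about \<open>L\<close>; as \<open>\<phi>\<close> is bounded by \<open>B\<close>, after \<open>k\<close> steps \<open>L\<close> is at most about \<open>2 * B / k\<close>.
\<close>

lemma backward_drift:
  fixes g \<phi> :: "nat \<Rightarrow> 'b \<Rightarrow> real"
  assumes "a > 0"
    and g_le: "\<And>n z. z \<in> Z \<Longrightarrow> \<bar>g n z\<bar> \<le> C"
    and \<phi>_le: "\<And>n z. z \<in> Z \<Longrightarrow> \<bar>\<phi> n z\<bar> \<le> B"
    and step: "\<And>L b n z. \<lbrakk>n \<ge> start; \<forall>z\<in>Z. g n z \<le> L + a; b \<ge> a; z \<in> Z; g (Suc n) z \<ge> L - b\<rbrakk> \<Longrightarrow>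
       \<exists>z'\<in>Z. g n z' \<ge> L - 7 * b \<and> \<phi> n z' \<le> \<phi> (Suc n) z - L + 7 * b"
    and "k > 0"
  shows "\<exists>N. \<forall>n\<ge>N. \<forall>z\<in>Z. g n z \<le> 2 * B / k + (7 ^ k + 1) * a"
proof (cases "Z = {}")
  case False
  \<comment> \<open>\<open>L\<close> is the limit superior in time of the supremum of
    \<open>g n\<close> over \<open>Z\<close>, written as the infimum of the eventual upper
    bounds.\<close>
  define A where "A = {l. \<exists>N. \<forall>n\<ge>N. \<forall>z\<in>Z. g n z \<le> l}"
  define L where "L = Inf A"
  have "C \<in> A"
    using g_le by (force simp: A_def abs_le_iff)
  moreover have "- C \<le> l" if "l \<in> A" for l
  proof -
    obtain N z where "z \<in> Z" "g N z \<le> l"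
      using \<open>l \<in> A\<close> False by (auto simp: A_def)
    then show ?thesis
      using g_le[of z N] by auto
  qed
  ultimately have A: "A \<noteq> {}" "bdd_below A"
    by (auto simp: bdd_below_def)
  obtain l where "l \<in> A" "l < L + a"
    using cInf_less_iff[OF A, of "L + a"] \<open>a > 0\<close> by (auto simp: L_def)
  then obtain N1 where N1: "\<forall>n\<ge>N1. \<forall>z\<in>Z. g n z \<le> l"
    by (auto simp: A_def)
  define N where "N = max N1 start"
  have "N \<ge> start"
    by (simp add: N_def)
  have N: "g n z \<le> L + a" if "n \<ge> N" "z \<in> Z" for n z
  proof -
    have "g n z \<le> l"
      using N1 that by (simp add: N_def)
    then show "g n z \<le> L + a"
      using \<open>l < L + a\<close> by linarith
  qed
  \<comment> \<open>Values of at least \<open>L - a\<close> recur at arbitrarily late times;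
    starting at \<open>m \<ge> N + k\<close> leaves room for \<open>k\<close> steps back within the
    range where \<open>N\<close> applies.\<close>
  have "L - a \<notin> A"
    using cInf_lower[OF _ A(2), of "L - a"] \<open>a > 0\<close> by (auto simp: L_def)
  then obtain m z where m: "m \<ge> N + k" "z \<in> Z" "g m z \<ge> L - a"
    unfolding A_def by (simp add: not_le) (meson less_imp_le)
  have "\<exists>z'\<in>Z. g (m - i) z' \<ge> L - 7 ^ i * a \<and>
      \<phi> (m - i) z' \<le> \<phi> m z - real i * L + real i * 7 ^ i * a"
    if "i \<le> k" for i
    using that
  proof (induction i)
    case 0
    then show ?case using m by auto
  next
    case (Suc i)
    then obtain z' where z': "z' \<in> Z" "g (m - i) z' \<ge> L - 7 ^ i * a"
      "\<phi> (m - i) z' \<le> \<phi> m z - real i * L + real i * 7 ^ i * a"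
      by auto
    have eq: "Suc (m - Suc i) = m - i"
      using m(1) Suc.prems by auto
    have "\<exists>z''\<in>Z. g (m - Suc i) z'' \<ge> L - 7 * (7 ^ i * a) \<and>
        \<phi> (m - Suc i) z'' \<le> \<phi> (Suc (m - Suc i)) z' - L + 7 * (7 ^ i * a)"
    proof (rule step)
      show "start \<le> m - Suc i"
        using m(1) Suc.prems \<open>N \<ge> start\<close> by auto
      show "\<forall>z\<in>Z. g (m - Suc i) z \<le> L + a"
        using m(1) Suc.prems N by auto
      show "a \<le> 7 ^ i * a"
        using \<open>a > 0\<close> by simp
    qed (use z' eq in auto)
    then obtain z'' where z'': "z'' \<in> Z" "g (m - Suc i) z'' \<ge> L - 7 ^ Suc i * a"
        "\<phi> (m - Suc i) z'' \<le> \<phi> (m - i) z' - L + 7 ^ Suc i * a"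
      using eq by (auto simp: mult.assoc)
    have "i * (7 ^ i * a) \<le> i * (7 ^ Suc i * a)"
      using \<open>a > 0\<close> by (intro mult_left_mono) auto
    then have "\<phi> (m - Suc i) z'' \<le> \<phi> m z - real (Suc i) * L + real (Suc i) * 7 ^ Suc i * a"
      using z'' z' by (simp add: algebra_simps)
    with z'' show ?case
      by (intro bexI[of _ z''] conjI)
  qed
  from this[of k] obtain z' where "z' \<in> Z"
    "\<phi> (m - k) z' \<le> \<phi> m z - real k * L + real k * 7 ^ k * a"
    by auto
  then have "k * (L - 7 ^ k * a) \<le> 2 * B"
    using \<phi>_le[of z m] \<phi>_le[of z' "m - k"] m by (auto simp: algebra_simps)
  then have "L - 7 ^ k * a \<le> 2 * B / k"
    using \<open>k > 0\<close> by (simp add: field_simps)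
  then have "L + a \<le> 2 * B / k + (7 ^ k + 1) * a"
    by (simp add: algebra_simps)
  with N show ?thesis
    by (intro exI[of _ N] allI impI ballI) (rule order_trans)
qed auto

text \<open>The order of choice matters: first \<open>k\<close>, to make the drift term small, and
  then \<open>a\<close>, to absorb the factor \<open>7 ^ k + 1\<close>, which depends on
  \<open>k\<close>.\<close>

lemma drift_parameters:
  fixes e :: real
  assumes "e > 0"
  obtains k :: nat and a where "k > 0" "a > 0" "2 * B / k + (7 ^ k + 1) * a \<le> e"
proof -
  obtain k :: nat where "4 * B / e < k"
    using reals_Archimedean2 by blast
  then have B: "2 * B / Suc k \<le> e / 2"
    using \<open>e > 0\<close> by (simp add: field_simps)
  define p where "p = (7 :: real) ^ Suc k + 1"
  have "p > 0"
    unfolding p_def by (intro add_pos_pos zero_less_power) simp_all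
  define a where "a = e / 2 / p"
  have "a > 0" "p * a = e / 2"
    using \<open>p > 0\<close> \<open>e > 0\<close> by (simp_all add: a_def)
  show thesis
  proof (rule that[of "Suc k" a])
    show "2 * B / Suc k + (7 ^ Suc k + 1) * a \<le> e"
      using B \<open>p * a = e / 2\<close> unfolding p_def by linarith
  qed (use \<open>a > 0\<close> in simp_all)
qed

section \<open>Extraction of a uniformly convergent subsequence\<close>

text \<open>A form of the Arzela-Ascoli theorem: finite nets that serve from a time \<open>N\<close>
  on replace equicontinuity and total boundedness. A diagonal sequence converges at the countably
  many net points, and a three-part estimate through a matching net point carries this over to
  \<open>V\<close>.\<close>

lemma uniformly_convergent_subsequence:
  fixes u :: "nat \<Rightarrow> 'a \<Rightarrow> real"
  assumes bound: "\<And>n x. x \<in> V \<Longrightarrow> \<bar>u n x\<bar> \<le> B"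
    and net: "\<And>e. e > 0 \<Longrightarrow> \<exists>D N. finite D \<and> D \<subseteq> V \<and> (\<forall>x\<in>V. \<exists>y\<in>D. \<forall>n\<ge>N. \<bar>u n x - u n y\<bar> \<le> e)"
  obtains r where "strict_mono (r :: nat \<Rightarrow> nat)" "uniformly_convergent_on V (\<lambda>n. u (r n))"
proof -
  have "\<forall>i. \<exists>D N. finite D \<and> D \<subseteq> V \<and> (\<forall>x\<in>V. \<exists>y\<in>D. \<forall>n\<ge>N. \<bar>u n x - u n y\<bar> \<le> 1 / Suc i)"
    using net by simp
  then obtain D N where D: "\<And>i. finite (D i)" "\<And>i. D i \<subseteq> V"
    and N: "\<And>i x. x \<in> V \<Longrightarrow> \<exists>y\<in>D i. \<forall>n\<ge>N i. \<bar>u n x - u n y\<bar> \<le> 1 / Suc i"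
    by metis
  have "countable (\<Union>i. D i)"
    using D by (auto intro: countable_finite)
  then obtain r where r: "strict_mono (r :: nat \<Rightarrow> nat)"
    and lim: "\<And>x. x \<in> (\<Union>i. D i) \<Longrightarrow> \<exists>l. (\<lambda>n. u (r n) x) \<longlonglongrightarrow> l"
    using D bound function_convergent_subsequence[of "\<Union>i. D i" u B]
    by (metis UN_E real_norm_def subsetD)
  have "uniformly_Cauchy_on V (\<lambda>n. u (r n))"
  proof (rule uniformly_Cauchy_onI)
    fix e :: real
    assume "e > 0"
    then obtain i where i: "1 / Suc i < e / 3"
      using nat_approx_posE[of "e / 3"] by auto
    have "\<forall>y\<in>D i. \<exists>M. \<forall>m\<ge>M. \<forall>n\<ge>M. dist (u (r m) y) (u (r n) y) < e / 3"
    proof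
      fix y assume "y \<in> D i"
      then have "Cauchy (\<lambda>n. u (r n) y)"
        using lim by (auto intro: LIMSEQ_imp_Cauchy)
      then show "\<exists>M. \<forall>m\<ge>M. \<forall>n\<ge>M. dist (u (r m) y) (u (r n) y) < e / 3"
        using \<open>e > 0\<close> unfolding Cauchy_def by (meson divide_pos_pos zero_less_numeral)
    qed
    then obtain M where M: "\<And>y m n. y \<in> D i \<Longrightarrow> m \<ge> M y \<Longrightarrow> n \<ge> M y \<Longrightarrow>
        dist (u (r m) y) (u (r n) y) < e / 3"
      by metis
    \<comment> \<open>A common threshold for the finitely many net points. It is at least
      \<open>N i\<close>, so \<open>r m \<ge> m\<close> brings the net estimate into force.\<close>
    define K where "K = Max (insert (N i) (M ` D i))"
    have K: "N i \<le> K" "\<And>y. y \<in> D i \<Longrightarrow> M y \<le> K"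
      using D(1)[of i] by (auto simp: K_def)
    show "\<exists>M. \<forall>x\<in>V. \<forall>m\<ge>M. \<forall>n\<ge>M. dist (u (r m) x) (u (r n) x) < e"
    proof (intro exI[of _ K] ballI allI impI)
      fix x m n assume "x \<in> V" and mn: "K \<le> m" "K \<le> n"
      obtain y where y: "y \<in> D i" and near: "\<And>n. n \<ge> N i \<Longrightarrow> \<bar>u n x - u n y\<bar> \<le> 1 / Suc i"
        using N[OF \<open>x \<in> V\<close>] by metis
      have "dist (u (r m) y) (u (r n) y) < e / 3"
        using M y K(2)[OF y] mn by (meson order_trans)
      moreover have "N i \<le> r m" "N i \<le> r n"
        using strict_mono_imp_increasing[OF r, of m] strict_mono_imp_increasing[OF r, of n] mn K(1)
        by linarith+
      ultimately show "dist (u (r m) x) (u (r n) x) < e"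
        using near[of "r m"] near[of "r n"] i unfolding dist_real_def by linarith
    qed
  qed
  then show thesis
    using r by (intro that) (auto intro: Cauchy_uniformly_convergent)
qed

section \<open>Compact length spaces\<close>

text \<open>Unless \<open>y\<close> itself serves, a path of length below \<open>e + r\<close> from
  \<open>x\<close> to \<open>y\<close> passes, by continuity, through a point at distance exactly
  \<open>e\<close> from \<open>x\<close>, and less than \<open>r\<close> of its length
  remains.\<close>

lemma compact_length_space_between:
  assumes cls: "compact_length_space V d" and "x \<in> V" "y \<in> V"
    and "d x y < e + r" "e \<ge> 0" "r > 0"
  obtains z where "z \<in> V" "d x z \<le> e" "d z y < r"
proof -
  interpret Metric_space V d
    using cls by (simp add: compact_length_space_def)
  show thesis
  proof (cases "d x y \<le> e")
    case True
    then show ?thesis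
      using assms that[of y] by simp
  next
    case False
    have "(INF g \<in> rectifiable_paths V d x y. path_length d g) < ennreal (e + r)"
      using assms unfolding compact_length_space_def
      by (metis ennreal_less_iff nonneg)
    then obtain g where g: "g \<in> rectifiable_paths V d x y" and len: "path_length d g < ennreal (e + r)"
      by (auto simp: INF_less_iff)
    have path: "pathin mtopology g" and g01: "g 0 = x" "g 1 = y"
      using g by (auto simp: rectifiable_paths_def)
    have gV: "g t \<in> V" if "t \<in> {0..1}" for t
      using path that by (auto simp: pathin_def continuous_map_def)
    have "continuous_map (subtopology euclideanreal {0..1}) euclideanreal (\<lambda>t. d x (g t))"
      using path \<open>x \<in> V\<close> unfolding pathin_def
      using continuous_map_mdist[of "subtopology euclideanreal {0..1}" "metric (V, d)" "\<lambda>_. x" g]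
      by simp
    then have "continuous_on {0..1} (\<lambda>t. d x (g t))"
      by simp
    then obtain t where t: "0 \<le> t" "t \<le> 1" "d x (g t) = e"
      using IVT'[of "\<lambda>t. d x (g t)" 0 e 1] False \<open>x \<in> V\<close> \<open>e \<ge> 0\<close> g01 by auto
    \<comment> \<open>The partition \<open>0, t, 1\<close> bounds the length of the path from below
      by the sum of the two distances.\<close>
    define s where "s i = (if i = 0 then 0 else if i = 1 then t else 1)" for i :: nat
    have "mono_on {..2} s"
      using t by (auto simp: s_def mono_on_def)
    then have "(2, s) \<in> {(n, t). t 0 = 0 \<and> t n = 1 \<and> mono_on {..n} t}"
      by (simp add: s_def)
    then have "(\<Sum>i<2. ennreal (d (g (s i)) (g (s (Suc i))))) \<le> path_length d g"
      unfolding path_length_def by (rule SUP_upper2) simp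
    then have "ennreal (d x (g t)) + ennreal (d (g t) y) \<le> path_length d g"
      by (simp add: s_def g01 numeral_2_eq_2)
    then have "ennreal (d x (g t) + d (g t) y) < ennreal (e + r)"
      using len by (simp add: ennreal_plus)
    then have "d x (g t) + d (g t) y < e + r"
      by (simp add: ennreal_less_iff del: ennreal_plus)
    then show ?thesis
      using t gV by (intro that[of "g t"]) auto
  qed
qed

text \<open>Each edge uses up \<open>\<epsilon>\<close> of the distance, and the strict bound
  survives the induction. As the metric is bounded, this bounds the diameter of the graph.\<close>

lemma adjacency_edges_relpow:
  assumes cls: "compact_length_space V d" and "\<epsilon> > 0"
    and "x \<in> V" "y \<in> V" "d x y < real (Suc k) * \<epsilon>"
  shows "(x, y) \<in> adjacency_edges V d \<epsilon> ^^ Suc k"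
  using assms(3-5)
proof (induction k arbitrary: x)
  case 0
  then show ?case by (simp add: adjacency_edges_def)
next
  case (Suc k)
  have "d x y < \<epsilon> + real (Suc k) * \<epsilon>"
    using Suc.prems by (simp add: algebra_simps)
  then obtain z where z: "z \<in> V" "d x z \<le> \<epsilon>" "d z y < real (Suc k) * \<epsilon>"
    using compact_length_space_between[OF cls Suc.prems(1,2)] \<open>\<epsilon> > 0\<close>
    by (metis less_imp_le mult_pos_pos of_nat_0_less_iff zero_less_Suc)
  have "(x, z) \<in> adjacency_edges V d \<epsilon>"
    using z Suc.prems by (simp add: adjacency_edges_def)
  with Suc.IH[OF z(1) Suc.prems(2) z(3)] show ?case
    by (meson relpow_Suc_I2)
qed

section \<open>Game values\<close>

text \<open>Common ground of both kinds of graph. Loops make every neighbourhood nonempty, and the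
  bounded payoff keeps game values bounded, so the extrema over neighbours are genuine.\<close>

locale tug_of_war =
  fixes V :: "'a set" and E :: "('a \<times> 'a) set" and f :: "'a \<Rightarrow> real"
  assumes edges: "E \<subseteq> V \<times> V"
    and loop: "x \<in> V \<Longrightarrow> (x, x) \<in> E"
    and bounded_payoff: "bounded (f ` V)"
begin

definition nbr_inf :: "('a \<Rightarrow> real) \<Rightarrow> 'a \<Rightarrow> real"
  where "nbr_inf h x = (INF y\<in>E `` {x}. h y)"

definition nbr_sup :: "('a \<Rightarrow> real) \<Rightarrow> 'a \<Rightarrow> real"
  where "nbr_sup h x = (SUP y\<in>E `` {x}. h y)"

lemma game_value_Suc:
  "game_value E f u0 (Suc n) x =
     nbr_inf (game_value E f u0 n) x / 2 + nbr_sup (game_value E f u0 n) x / 2 + f x"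
  by (simp add: nbr_inf_def nbr_sup_def)

declare game_value.simps(2) [simp del]

lemma bdd_nbr:
  fixes h :: "'a \<Rightarrow> real"
  assumes "bounded (h ` V)"
  shows "bdd_below (h ` (E `` {x}))" "bdd_above (h ` (E `` {x}))"
proof -
  have "bounded (h ` (E `` {x}))"
    using edges by (intro bounded_subset[OF assms]) auto
  then show "bdd_below (h ` (E `` {x}))" "bdd_above (h ` (E `` {x}))"
    by (simp_all add: bounded_imp_bdd_below bounded_imp_bdd_above)
qed

lemma nbr_inf_le: "bounded (h ` V) \<Longrightarrow> (x, y) \<in> E \<Longrightarrow> nbr_inf h x \<le> h y"
  unfolding nbr_inf_def by (rule cINF_lower) (auto intro: bdd_nbr)

lemma le_nbr_sup: "bounded (h ` V) \<Longrightarrow> (x, y) \<in> E \<Longrightarrow> h y \<le> nbr_sup h x"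
  unfolding nbr_sup_def by (rule cSUP_upper) (auto intro: bdd_nbr)

lemma nbr_inf_greatest: "x \<in> V \<Longrightarrow> (\<And>y. (x, y) \<in> E \<Longrightarrow> c \<le> h y) \<Longrightarrow> c \<le> nbr_inf h x"
  unfolding nbr_inf_def using loop by (intro cINF_greatest) auto

lemma nbr_sup_least: "x \<in> V \<Longrightarrow> (\<And>y. (x, y) \<in> E \<Longrightarrow> h y \<le> c) \<Longrightarrow> nbr_sup h x \<le> c"
  unfolding nbr_sup_def using loop by (intro cSUP_least) auto

lemma nbr_inf_approx:
  assumes "x \<in> V" "e > 0"
  obtains y where "(x, y) \<in> E" "h y < nbr_inf h x + e"
  using nbr_inf_greatest[of x "nbr_inf h x + e" h] assms by force

lemma nbr_sup_approx:
  assumes "x \<in> V" "e > 0"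
  obtains y where "(x, y) \<in> E" "nbr_sup h x - e < h y"
  using nbr_sup_least[of x h "nbr_sup h x - e"] assms by force

text \<open>A coupling form: neighbours of \<open>x'\<close> are matched with neighbours of
  \<open>x\<close>. With \<open>x = x'\<close> it gives monotonicity of a round; with nearby points
  it compares values on adjacency graphs.\<close>

lemma nbr_inf_diff_le:
  assumes "bounded (g ` V)" "x' \<in> V"
    and "\<And>y'. (x', y') \<in> E \<Longrightarrow> \<exists>y. (x, y) \<in> E \<and> g y \<le> h y' + c"
  shows "nbr_inf g x \<le> nbr_inf h x' + c"
proof -
  have "nbr_inf g x - c \<le> nbr_inf h x'"
    using assms nbr_inf_le[OF assms(1)] by (intro nbr_inf_greatest) force+
  then show ?thesis by simp
qed

lemma nbr_sup_diff_le:
  assumes "bounded (h ` V)" "x \<in> V"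
    and "\<And>y. (x, y) \<in> E \<Longrightarrow> \<exists>y'. (x', y') \<in> E \<and> g y \<le> h y' + c"
  shows "nbr_sup g x \<le> nbr_sup h x' + c"
  using assms le_nbr_sup[OF assms(1)] by (intro nbr_sup_least) force+

lemma bounded_nbr:
  assumes "bounded (h ` V)"
  shows "bounded (nbr_inf h ` V)" "bounded (nbr_sup h ` V)"
proof -
  obtain B where "\<forall>x\<in>V. \<bar>h x\<bar> \<le> B"
    using assms by (auto simp: bounded_image_real_iff)
  then have B: "- B \<le> h y" "h y \<le> B" if "(x, y) \<in> E" for x y
    using edges that by force+
  have "\<bar>nbr_inf h x\<bar> \<le> B" if "x \<in> V" for x
    using nbr_inf_le[OF assms loop[OF that]] nbr_inf_greatest[of x "- B" h] that B loop[OF that]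
    by force
  moreover have "\<bar>nbr_sup h x\<bar> \<le> B" if "x \<in> V" for x
    using le_nbr_sup[OF assms loop[OF that]] nbr_sup_least[of x h B] that B loop[OF that]
    by force
  ultimately show "bounded (nbr_inf h ` V)" "bounded (nbr_sup h ` V)"
    by (auto simp: bounded_image_real_iff)
qed

lemma bounded_game_value:
  assumes "bounded (u0 ` V)"
  shows "bounded (game_value E f u0 n ` V)"
proof (induction n)
  case 0
  then show ?case by (simp add: assms)
next
  case (Suc n)
  obtain A B C where ABC: "\<forall>x\<in>V. \<bar>nbr_inf (game_value E f u0 n) x\<bar> \<le> A"
    "\<forall>x\<in>V. \<bar>nbr_sup (game_value E f u0 n) x\<bar> \<le> B" "\<forall>x\<in>V. \<bar>f x\<bar> \<le> C"
    using bounded_nbr[OF Suc] bounded_payoff unfolding bounded_image_real_iff by blast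
  have "\<bar>game_value E f u0 (Suc n) x\<bar> \<le> A + B + C" if "x \<in> V" for x
  proof -
    have "\<bar>p / 2 + q / 2 + r\<bar> \<le> A + B + C"
      if "\<bar>p\<bar> \<le> A" "\<bar>q\<bar> \<le> B" "\<bar>r\<bar> \<le> C" for p q r
      using that abs_ge_zero[of p] abs_ge_zero[of q] by linarith
    with ABC \<open>x \<in> V\<close> show ?thesis
      unfolding game_value_Suc by blast
  qed
  then show ?case
    unfolding bounded_image_real_iff by blast
qed

lemma nbr_mono:
  assumes "bounded (g ` V)" "bounded (h ` V)" "\<And>y. y \<in> V \<Longrightarrow> g y \<le> h y + c" "x \<in> V"
  shows "nbr_inf g x \<le> nbr_inf h x + c" "nbr_sup g x \<le> nbr_sup h x + c"
  using assms edges by (blast intro!: nbr_inf_diff_le nbr_sup_diff_le)+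

text \<open>Comparison principle: a round is monotone and commutes with adding constants. The
  separate times \<open>m\<close> and \<open>n\<close> allow a game to be compared with a later
  stage of another one or of itself.\<close>

lemma game_value_mono:
  assumes "bounded (u0 ` V)" "bounded (w0 ` V)"
    and "\<And>x. x \<in> V \<Longrightarrow> game_value E f u0 m x \<le> game_value E f w0 n x + c" "x \<in> V"
  shows "game_value E f u0 (m + k) x \<le> game_value E f w0 (n + k) x + c"
  using assms(4)
proof (induction k arbitrary: x)
  case 0
  then show ?case using assms(3) by simp
next
  case (Suc k)
  have "nbr_inf (game_value E f u0 (m + k)) x \<le> nbr_inf (game_value E f w0 (n + k)) x + c"
    "nbr_sup (game_value E f u0 (m + k)) x \<le> nbr_sup (game_value E f w0 (n + k)) x + c"
    using Suc by (intro nbr_mono bounded_game_value assms(1,2); simp)+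
  then show ?case
    unfolding add_Suc_right game_value_Suc by linarith
qed


section \<open>Increments tend to zero uniformly\<close>

text \<open>The drift argument with \<open>g\<close> the increment and \<open>\<phi>\<close> the
  value itself: a nearly maximal increment is traced back to a nearly minimising neighbour.\<close>

lemma increment_le_eventually:
  assumes "bounded (u0 ` V)"
    and B: "\<And>n x. x \<in> V \<Longrightarrow> \<bar>game_value E f u0 n x\<bar> \<le> B"
    and "e > 0"
  shows "\<exists>N. \<forall>n\<ge>N. \<forall>x\<in>V. game_value E f u0 (Suc n) x - game_value E f u0 n x \<le> e"
proof -
  let ?u = "game_value E f u0"
  note u_bdd = bounded_game_value[OF assms(1)]
  obtain k a where k: "k > 0" and "a > 0" and small: "2 * B / real k + (7 ^ k + 1) * a \<le> e"
    using drift_parameters[OF \<open>e > 0\<close>] .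
  have "\<exists>N. \<forall>n\<ge>N. \<forall>x\<in>V. ?u (Suc n) x - ?u n x \<le> 2 * B / k + (7 ^ k + 1) * a"
  proof (rule backward_drift[where \<phi> = ?u and C = "2 * B" and start = 0])
    fix n x assume "x \<in> V"
    then show "\<bar>?u (Suc n) x - ?u n x\<bar> \<le> 2 * B"
      using B[of x n] B[of x "Suc n"] by linarith
  next
    fix L b :: real and n x
    assume le: "\<forall>z\<in>V. ?u (Suc n) z - ?u n z \<le> L + a" and "a \<le> b" and "x \<in> V"
      and ge: "L - b \<le> ?u (Suc (Suc n)) x - ?u (Suc n) x"
    obtain y where y: "(x, y) \<in> E" "?u n y < nbr_inf (?u n) x + a"
      using nbr_inf_approx[OF \<open>x \<in> V\<close> \<open>a > 0\<close>] by metis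
    \<comment> \<open>The supremum over neighbours can rise by at most \<open>L + a\<close>, so the
      infimum must account for the rest of the increment at \<open>x\<close>.\<close>
    have "nbr_sup (?u (Suc n)) x \<le> nbr_sup (?u n) x + (L + a)"
      using le \<open>x \<in> V\<close> by (intro nbr_mono u_bdd) force+
    then have "nbr_inf (?u n) x + L - 2 * b - a \<le> nbr_inf (?u (Suc n)) x"
      using ge unfolding game_value_Suc[of u0 "Suc n"] game_value_Suc[of u0 n x] by linarith
    \<comment> \<open>The first bound makes the increment at \<open>y\<close> nearly
      \<open>L\<close>; the second, from the loop at \<open>x\<close>, makes the value drop by
      nearly \<open>L\<close> on going back to \<open>y\<close>.\<close>
    moreover have "nbr_inf (?u (Suc n)) x \<le> ?u (Suc n) y" "nbr_inf (?u (Suc n)) x \<le> ?u (Suc n) x"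
      using nbr_inf_le[OF u_bdd] y loop[OF \<open>x \<in> V\<close>] by blast+
    moreover have "y \<in> V"
      using edges y by auto
    ultimately show "\<exists>y\<in>V. L - 7 * b \<le> ?u (Suc n) y - ?u n y \<and> ?u n y \<le> ?u (Suc n) x - L + 7 * b"
      using y \<open>a > 0\<close> \<open>a \<le> b\<close> by (intro bexI[of _ y] conjI; linarith)
  qed (use B k \<open>a > 0\<close> in auto)
  then show ?thesis
    using small by (meson order_trans)
qed

text \<open>Negation exchanges the two players, which turns the upper bound on increments into a
  lower one.\<close>

lemma game_value_uminus:
  "game_value E (\<lambda>x. - f x) (\<lambda>x. - u0 x) n x = - game_value E f u0 n x"
proof (induction n arbitrary: x)
  case (Suc n)
  have "(INF y\<in>S. - h y) = - (SUP y\<in>S. h y)" for S and h :: "'a \<Rightarrow> real"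
    by (simp add: Inf_real_def image_image)
  moreover from this[of "\<lambda>y. - h y" for h] have "(SUP y\<in>S. - h y) = - (INF y\<in>S. h y)"
    for S and h :: "'a \<Rightarrow> real"
    by simp
  ultimately show ?case
    by (simp add: game_value.simps(2) Suc field_simps)
qed simp

lemma increment_tendsto_0:
  assumes "bounded (u0 ` V)"
    and B: "\<And>n x. x \<in> V \<Longrightarrow> \<bar>game_value E f u0 n x\<bar> \<le> B"
    and "e > 0"
  shows "\<exists>N. \<forall>n\<ge>N. \<forall>x\<in>V. \<bar>game_value E f u0 (Suc n) x - game_value E f u0 n x\<bar> \<le> e"
proof -
  interpret neg: tug_of_war V E "\<lambda>x. - f x"
    using edges loop bounded_payoff by unfold_locales (auto simp: bounded_image_real_iff)
  obtain N1 where "\<forall>n\<ge>N1. \<forall>x\<in>V. game_value E f u0 (Suc n) x - game_value E f u0 n x \<le> e"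
    using increment_le_eventually[OF assms] by blast
  moreover obtain N2
    where "\<forall>n\<ge>N2. \<forall>x\<in>V. - game_value E f u0 (Suc n) x - - game_value E f u0 n x \<le> e"
    using neg.increment_le_eventually[of "\<lambda>x. - u0 x" B e] assms
    unfolding game_value_uminus by (auto simp: bounded_image_real_iff)
  ultimately show ?thesis
    by (intro exI[of _ "max N1 N2"]) (auto simp: abs_le_iff)
qed

section \<open>From a convergent subsequence to convergence\<close>

text \<open>The limit \<open>v\<close> of a subsequence is fixed by a round, since increments
  vanish. Rounds being nonexpansive, a distance to \<open>v\<close> that is small at one time
  \<open>r j\<close> stays small.\<close>

lemma uniformly_convergent_game_value:
  assumes u0: "bounded (u0 ` V)"
    and B: "\<And>n x. x \<in> V \<Longrightarrow> \<bar>game_value E f u0 n x\<bar> \<le> B"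
    and net: "\<And>e. e > 0 \<Longrightarrow> \<exists>D N. finite D \<and> D \<subseteq> V \<and>
      (\<forall>x\<in>V. \<exists>y\<in>D. \<forall>n\<ge>N. \<bar>game_value E f u0 n x - game_value E f u0 n y\<bar> \<le> e)"
  shows "uniformly_convergent_on V (game_value E f u0)"
proof -
  let ?u = "game_value E f u0"
  obtain r v where r: "strict_mono (r :: nat \<Rightarrow> nat)"
    and v: "uniform_limit V (\<lambda>j. ?u (r j)) v sequentially"
    using uniformly_convergent_subsequence[OF B net] unfolding uniformly_convergent_on_def by metis
  have near: "\<exists>j\<ge>N. \<forall>x\<in>V. \<bar>?u (r j) x - v x\<bar> \<le> e" if "e > 0" for e N
  proof -
    have "\<forall>\<^sub>F j in sequentially. \<forall>x\<in>V. dist (?u (r j) x) (v x) < e"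
      using v \<open>e > 0\<close> by (simp add: uniform_limit_iff)
    then obtain N' where "\<forall>j\<ge>N'. \<forall>x\<in>V. dist (?u (r j) x) (v x) < e"
      by (auto simp: eventually_sequentially)
    then show ?thesis
      by (intro exI[of _ "max N N'"]) (auto simp: dist_real_def less_imp_le)
  qed
  have v_bdd: "bounded (v ` V)"
  proof -
    obtain j where "\<forall>x\<in>V. \<bar>?u (r j) x - v x\<bar> \<le> 1"
      using near[of 1 0] by auto
    then have "\<forall>x\<in>V. \<bar>v x\<bar> \<le> B + 1"
      using B by (smt (verit))
    then show ?thesis
      by (auto simp: bounded_image_real_iff)
  qed
  have fixed: "game_value E f v 1 x = v x" if "x \<in> V" for x
  proof -
    have "\<bar>game_value E f v 1 x - v x\<bar> \<le> e" if "e > 0" for e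
    proof -
      obtain N where N: "\<forall>n\<ge>N. \<forall>x\<in>V. \<bar>?u (Suc n) x - ?u n x\<bar> \<le> e / 3"
        using increment_tendsto_0[OF u0 B, of "e / 3"] \<open>e > 0\<close> by auto
      obtain j where "j \<ge> N" and j: "\<forall>x\<in>V. \<bar>?u (r j) x - v x\<bar> \<le> e / 3"
        using near[of "e / 3"] \<open>e > 0\<close> by auto
      have *: "?u (r j) y \<le> v y + e / 3" "v y \<le> ?u (r j) y + e / 3" if "y \<in> V" for y
        using bspec[OF j that] by linarith+
      \<comment> \<open>One round from \<open>v\<close> and one from the game at time
        \<open>r j\<close> end within \<open>e / 3\<close> of each other.\<close>
      have "?u (r j + 1) x \<le> game_value E f v (0 + 1) x + e / 3"
        using * \<open>x \<in> V\<close> by (intro game_value_mono u0 v_bdd) auto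
      moreover have "game_value E f v (0 + 1) x \<le> ?u (r j + 1) x + e / 3"
        using * \<open>x \<in> V\<close> by (intro game_value_mono u0 v_bdd) auto
      moreover have "r j \<ge> N"
        using \<open>j \<ge> N\<close> strict_mono_imp_increasing[OF r, of j] by linarith
      then have "\<bar>?u (r j + 1) x - ?u (r j) x\<bar> \<le> e / 3"
        using N \<open>x \<in> V\<close> by simp
      moreover have "\<bar>?u (r j) x - v x\<bar> \<le> e / 3"
        using j \<open>x \<in> V\<close> by simp
      ultimately show ?thesis
        by (simp only: add_0)
    qed
    then have "\<bar>game_value E f v 1 x - v x\<bar> \<le> 0"
      by (rule field_le_epsilon) simp
    then show ?thesis by simp
  qed
  have stationary: "game_value E f v k x = v x" if "x \<in> V" for k x
    using that
  proof (induction k arbitrary: x)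
    case (Suc k)
    have "game_value E f v (1 + k) x \<le> game_value E f v (0 + k) x + 0"
      "game_value E f v (0 + k) x \<le> game_value E f v (1 + k) x + 0"
      using fixed Suc.prems by (intro game_value_mono v_bdd; simp del: One_nat_def)+
    then show ?case
      using Suc by simp
  qed simp
  have "uniform_limit V ?u v sequentially"
    unfolding uniform_limit_sequentially_iff
  proof (intro allI impI)
    fix e :: real
    assume "e > 0"
    then obtain j where j: "\<forall>x\<in>V. \<bar>?u (r j) x - v x\<bar> \<le> e / 2"
      using near[of "e / 2"] by auto
    have *: "?u (r j) y \<le> v y + e / 2" "v y \<le> ?u (r j) y + e / 2" if "y \<in> V" for y
      using bspec[OF j that] by linarith+
    have "\<bar>?u n x - v x\<bar> < e" if "n \<ge> r j" "x \<in> V" for n x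
    proof -
      have "?u (r j + (n - r j)) x \<le> game_value E f v (0 + (n - r j)) x + e / 2"
        using * \<open>x \<in> V\<close> by (intro game_value_mono u0 v_bdd) auto
      moreover have "game_value E f v (0 + (n - r j)) x \<le> ?u (r j + (n - r j)) x + e / 2"
        using * \<open>x \<in> V\<close> by (intro game_value_mono u0 v_bdd) auto
      ultimately show ?thesis
        using stationary[OF \<open>x \<in> V\<close>] \<open>n \<ge> r j\<close> \<open>e > 0\<close> by (simp add: abs_less_iff)
    qed
    then show "\<exists>N. \<forall>n\<ge>N. \<forall>x\<in>V. dist (?u n x) (v x) < e"
      by (auto simp: dist_real_def)
  qed
  then show ?thesis
    by (auto simp: uniformly_convergent_on_def)
qed


subsection \<open>Existence and uniqueness of the long term advantage\<close>

text \<open>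
  The one-round inequality bounds the rise at a vertex by the drop there, so the height above the
  minimum at most doubles, up to a constant, along each edge.
\<close>

lemma oscillation_chain:
  fixes h :: "'a \<Rightarrow> real"
  assumes "bounded (h ` V)" and le: "\<And>y. y \<in> V \<Longrightarrow> nbr_inf h y + nbr_sup h y \<le> 2 * h y + c"
    and m: "\<And>y. y \<in> V \<Longrightarrow> m \<le> h y" and "x \<in> V" "(x, y) \<in> E ^^ k"
  shows "h y - m + c \<le> 2 ^ k * (h x - m + c)"
  using assms(5)
proof (induction k arbitrary: y)
  case (Suc k)
  then obtain z where z: "(x, z) \<in> E ^^ k" "(z, y) \<in> E"
    by auto
  then have "z \<in> V"
    using edges by auto
  then have "m \<le> nbr_inf h z"
    using edges m by (intro nbr_inf_greatest) auto
  then have "h y \<le> 2 * h z + c - m"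
    using le[OF \<open>z \<in> V\<close>] le_nbr_sup[OF assms(1) z(2)] by linarith
  \<comment> \<open>Adding \<open>c\<close> to the height turns the recursion into exact
    doubling.\<close>
  then show ?case
    using Suc.IH[OF z(1)] by simp
qed simp

text \<open>The chain starts at a vertex within \<open>1\<close> of the infimum, which need not be
  attained, and reaches any vertex in at most \<open>K\<close> edges.\<close>

lemma oscillation_le:
  fixes h :: "'a \<Rightarrow> real"
  assumes "bounded (h ` V)" and le: "\<And>y. y \<in> V \<Longrightarrow> nbr_inf h y + nbr_sup h y \<le> 2 * h y + c"
    and "c \<ge> 0" and K: "\<And>x y. x \<in> V \<Longrightarrow> y \<in> V \<Longrightarrow> \<exists>k\<le>K. (x, y) \<in> E ^^ k"
    and "y \<in> V" "z \<in> V"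
  shows "h y - h z \<le> 2 ^ K * (1 + c)"
proof -
  define m where "m = (INF x\<in>V. h x)"
  have m: "m \<le> h x" if "x \<in> V" for x
    unfolding m_def using that assms(1) by (intro cINF_lower bounded_imp_bdd_below)
  have "\<exists>x\<in>V. h x < m + 1"
  proof (rule ccontr)
    assume "\<not> (\<exists>x\<in>V. h x < m + 1)"
    then have "m + 1 \<le> m"
      unfolding m_def using \<open>y \<in> V\<close> by (intro cINF_greatest) force+
    then show False by simp
  qed
  then obtain x where x: "x \<in> V" "h x < m + 1" by blast
  then obtain k where k: "k \<le> K" "(x, y) \<in> E ^^ k"
    using K \<open>y \<in> V\<close> by blast
  have "h y - h z \<le> h y - m + c"
    using m[OF \<open>z \<in> V\<close>] \<open>c \<ge> 0\<close> by simp
  also have "\<dots> \<le> 2 ^ k * (h x - m + c)"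
    using oscillation_chain[OF assms(1) le m x(1) k(2)] .
  also have "\<dots> \<le> 2 ^ K * (1 + c)"
    using k x m[OF x(1)] \<open>c \<ge> 0\<close> by (intro mult_mono power_increasing) auto
  finally show ?thesis .
qed

lemma nbr_zero [simp]:
  assumes "x \<in> V"
  shows "nbr_inf (\<lambda>_. 0) x = 0" "nbr_sup (\<lambda>_. 0) x = 0"
proof -
  have "E `` {x} \<noteq> {}"
    using loop[OF assms] by auto
  then show "nbr_inf (\<lambda>_. 0) x = 0" "nbr_sup (\<lambda>_. 0) x = 0"
    by (simp_all add: nbr_inf_def nbr_sup_def)
qed

text \<open>From zero terminal payoff, comparison with the first round keeps all increments at most
  \<open>F\<close>. This gives the one-round inequality with the same constant \<open>4 * F\<close>
  at all times.\<close>

lemma bounded_oscillation: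
  assumes K: "\<And>x y. x \<in> V \<Longrightarrow> y \<in> V \<Longrightarrow> \<exists>k\<le>K. (x, y) \<in> E ^^ k"
  obtains C where "C \<ge> 0"
    "\<And>n x y. x \<in> V \<Longrightarrow> y \<in> V \<Longrightarrow> game_value E f (\<lambda>_. 0) n x - game_value E f (\<lambda>_. 0) n y \<le> C"
proof -
  let ?u = "game_value E f (\<lambda>_. 0)"
  have zero: "bounded ((\<lambda>_. 0 :: real) ` V)"
    by (auto simp: bounded_image_real_iff)
  obtain F0 where F0: "\<forall>x\<in>V. \<bar>f x\<bar> \<le> F0"
    using bounded_payoff by (auto simp: bounded_image_real_iff)
  \<comment> \<open>The maximum with \<open>0\<close> covers the empty vertex set.\<close>
  define F where "F = max F0 0"
  have F: "\<bar>f x\<bar> \<le> F" if "x \<in> V" for x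
    using F0 that by (force simp: F_def)
  have "F \<ge> 0"
    by (simp add: F_def)
  have incr: "?u (Suc n) x \<le> ?u n x + F" if "x \<in> V" for n x
  proof -
    have "?u (1 + n) x \<le> ?u (0 + n) x + F"
    proof (rule game_value_mono[OF zero zero _ that])
      fix y assume "y \<in> V"
      then show "?u 1 y \<le> ?u 0 y + F"
        using F[of y] by (simp add: game_value_Suc)
    qed
    then show ?thesis by simp
  qed
  have "nbr_inf (?u n) y + nbr_sup (?u n) y \<le> 2 * ?u n y + 4 * F" if "y \<in> V" for n y
    using incr[OF that, of n] F[OF that] unfolding game_value_Suc[of "\<lambda>_. 0" n y] by linarith
  then have "?u n x - ?u n y \<le> 2 ^ K * (1 + 4 * F)" if "x \<in> V" "y \<in> V" for n x y
    using \<open>F \<ge> 0\<close> that by (intro oscillation_le[OF _ _ _ K] bounded_game_value zero) simp_all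
  then show thesis
    using \<open>F \<ge> 0\<close> by (intro that[of "2 ^ K * (1 + 4 * F)"]) auto
qed

text \<open>
  By bounded oscillation the values at a fixed vertex form a sequence that is additive up to the
  constant \<open>C\<close>.
\<close>

lemma long_term_advantage_exists:
  assumes "V \<noteq> {}" and K: "\<And>x y. x \<in> V \<Longrightarrow> y \<in> V \<Longrightarrow> \<exists>k\<le>K. (x, y) \<in> E ^^ k"
  shows "\<exists>c. \<forall>u0. bounded (u0 ` V) \<longrightarrow>
    (\<exists>B. \<forall>n. \<forall>x\<in>V. \<bar>game_value E f u0 n x - real n * c\<bar> \<le> B)"
proof -
  let ?u = "game_value E f (\<lambda>_. 0)"
  have zero: "bounded ((\<lambda>_. 0 :: real) ` V)"
    by (auto simp: bounded_image_real_iff)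
  obtain p where "p \<in> V"
    using assms(1) by auto
  obtain C where "C \<ge> 0" and C: "\<And>n x y. x \<in> V \<Longrightarrow> y \<in> V \<Longrightarrow> ?u n x - ?u n y \<le> C"
    using bounded_oscillation[OF K] by metis
  define a where "a n = ?u n p" for n
  have near: "\<bar>?u n x - a n\<bar> \<le> C" if "x \<in> V" for n x
    using C[OF that \<open>p \<in> V\<close>, of n] C[OF \<open>p \<in> V\<close> that, of n] by (simp add: a_def abs_le_iff)
  \<comment> \<open>After \<open>m\<close> rounds the value function is within \<open>C\<close> of
    the constant \<open>a m\<close>, so the next \<open>n\<close> rounds resemble a fresh game
    shifted by \<open>a m\<close>.\<close>
  have add: "a (m + n) \<le> a n + (a m + C)" "a n + (a m - C) \<le> a (m + n)" for m n
  proof -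
    have "?u (m + n) p \<le> ?u (0 + n) p + (a m + C)"
    proof (rule game_value_mono[OF zero zero _ \<open>p \<in> V\<close>])
      show "?u m x \<le> ?u 0 x + (a m + C)" if "x \<in> V" for x
        using near[OF that, of m] by (simp add: abs_le_iff)
    qed
    moreover have "?u (0 + n) p \<le> ?u (m + n) p + (C - a m)"
    proof (rule game_value_mono[OF zero zero _ \<open>p \<in> V\<close>])
      show "?u 0 x \<le> ?u m x + (C - a m)" if "x \<in> V" for x
        using near[OF that, of m] by (simp add: abs_le_iff)
    qed
    ultimately show "a (m + n) \<le> a n + (a m + C)" "a n + (a m - C) \<le> a (m + n)"
      by (simp_all add: a_def)
  qed
  have a0: "a 0 = 0"
    by (simp add: a_def)
  have mult_le: "a (j * m) \<le> real j * (a m + C)" for j m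
  proof (induction j)
    case (Suc j)
    then show ?case
      using add(1)[of m "j * m"] by (simp add: algebra_simps)
  qed (simp add: a0)
  have le_mult: "real j * (a m - C) \<le> a (j * m)" for j m
  proof (induction j)
    case (Suc j)
    then show ?case
      using add(2)[of "j * m" m] add(2)[of m "j * m"] by (simp add: algebra_simps)
  qed (simp add: a0)
  \<comment> \<open>Every lower slope \<open>(a k - C) / k\<close> is below every upper slope
    \<open>(a n + C) / n\<close>, as two bounds on \<open>a (n * k)\<close> show. The supremum of
    the lower ones separates the two families.\<close>
  define c where "c = (SUP k\<in>{0<..}. (a k - C) / real k)"
  have cross: "(a k - C) / k \<le> (a n + C) / n" if "k > 0" "n > 0" for k n
  proof -
    have "n * (a k - C) \<le> k * (a n + C)"
      using le_mult[of n k] mult_le[of k n] by (simp add: mult.commute)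
    then show ?thesis
      using that by (simp add: field_simps)
  qed
  have ac: "\<bar>a n - n * c\<bar> \<le> C" for n
  proof (cases "n = 0")
    case False
    then have "(a n - C) / n \<le> c"
      unfolding c_def using cross[of _ 1] by (intro cSUP_upper bdd_aboveI2[of _ _ "a 1 + C"]) auto
    moreover have "c \<le> (a n + C) / n"
      unfolding c_def using cross False by (intro cSUP_least) auto
    ultimately show ?thesis
      using False by (simp add: field_simps abs_le_iff)
  qed (simp add: a0 \<open>C \<ge> 0\<close>)
  show ?thesis
  proof (rule exI[of _ c], intro allI impI)
    fix u0 :: "'a \<Rightarrow> real"
    assume u0: "bounded (u0 ` V)"
    then obtain B where B: "\<And>x. x \<in> V \<Longrightarrow> \<bar>u0 x\<bar> \<le> B"
      by (auto simp: bounded_image_real_iff)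
    have "\<bar>game_value E f u0 n x - n * c\<bar> \<le> B + 2 * C" if "x \<in> V" for n x
    proof -
      have "game_value E f u0 (0 + n) x \<le> ?u (0 + n) x + B"
        using B by (intro game_value_mono[OF u0 zero _ that]) (force simp: abs_le_iff)
      moreover have "?u (0 + n) x \<le> game_value E f u0 (0 + n) x + B"
        using B by (intro game_value_mono[OF zero u0 _ that]) (force simp: abs_le_iff)
      ultimately show ?thesis
        using near[OF that, of n] ac[of n] by (simp add: abs_le_iff)
    qed
    then show "\<exists>B. \<forall>n. \<forall>x\<in>V. \<bar>game_value E f u0 n x - real n * c\<bar> \<le> B"
      by blast
  qed
qed

text \<open>Makes the definite description usable. It is unique because two such constants satisfy
  \<open>n * \<bar>c - c'\<bar> \<le> B + B'\<close> for all \<open>n\<close>.\<close>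

lemma long_term_advantage_bounded:
  assumes "V \<noteq> {}" and K: "\<And>x y. x \<in> V \<Longrightarrow> y \<in> V \<Longrightarrow> \<exists>k\<le>K. (x, y) \<in> E ^^ k"
    and "bounded (u0 ` V)"
  shows "\<exists>B. \<forall>n. \<forall>x\<in>V. \<bar>game_value E f u0 n x - n * long_term_advantage V E f\<bar> \<le> B"
proof -
  let ?P = "\<lambda>c. \<forall>u0. bounded (u0 ` V) \<longrightarrow>
    (\<exists>B. \<forall>n. \<forall>x\<in>V. \<bar>game_value E f u0 n x - real n * c\<bar> \<le> B)"
  have unique: "c = c'" if c: "?P c" and c': "?P c'" for c c'
  proof (rule ccontr)
    assume "c \<noteq> c'"
    obtain p where "p \<in> V"
      using assms(1) by auto
    obtain B B' where "\<forall>n. \<forall>x\<in>V. \<bar>game_value E f u0 n x - real n * c\<bar> \<le> B"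
      "\<forall>n. \<forall>x\<in>V. \<bar>game_value E f u0 n x - real n * c'\<bar> \<le> B'"
      using spec[OF c, of u0] spec[OF c', of u0] assms(3) by auto
    with \<open>p \<in> V\<close> have B: "\<bar>game_value E f u0 n p - real n * c\<bar> \<le> B"
      "\<bar>game_value E f u0 n p - real n * c'\<bar> \<le> B'" for n
      by auto
    have "n * \<bar>c - c'\<bar> \<le> B + B'" for n :: nat
    proof -
      have "n * \<bar>c - c'\<bar> = \<bar>real n * c - real n * c'\<bar>"
        by (simp add: abs_mult flip: right_diff_distrib)
      then show ?thesis
        using B[of n] by linarith
    qed
    then show False
      using reals_Archimedean3[of "\<bar>c - c'\<bar>"] \<open>c \<noteq> c'\<close>
      by (meson linorder_not_less zero_less_abs_iff right_minus_eq)
  qed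
  have "?P (long_term_advantage V E f)"
    unfolding long_term_advantage_def
    by (rule theI') (use long_term_advantage_exists[OF assms(1) K] unique in blast)
  then show ?thesis
    using assms(3) by blast
qed

section \<open>Asymptotic equicontinuity on adjacency graphs\<close>

text \<open>The drift argument on pairs of points closer than \<open>\<delta>\<close>:
  \<open>g\<close> is the difference of values and \<open>\<phi>\<close> the negated value at the
  first point, since that value rises going back in time.\<close>

lemma asymptotically_equicontinuous:
  assumes cls: "compact_length_space V d" and "\<epsilon> > 0" and E_eq: "E = adjacency_edges V d \<epsilon>"
    and f_cont: "\<And>e. e > 0 \<Longrightarrow> \<exists>\<delta>>0. \<forall>x\<in>V. \<forall>y\<in>V. d x y < \<delta> \<longrightarrow> \<bar>f x - f y\<bar> \<le> e"
    and u0: "bounded (u0 ` V)"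
    and B: "\<And>n x. x \<in> V \<Longrightarrow> \<bar>game_value E f u0 n x\<bar> \<le> B"
    and "e > 0"
  shows "\<exists>\<delta>>0. \<exists>N. \<forall>n\<ge>N. \<forall>x\<in>V. \<forall>y\<in>V. d x y < \<delta> \<longrightarrow>
    \<bar>game_value E f u0 n x - game_value E f u0 n y\<bar> \<le> e"
proof -
  interpret Metric_space V d
    using cls by (simp add: compact_length_space_def)
  let ?u = "game_value E f u0"
  note u_bdd = bounded_game_value[OF u0]
  obtain k a where k: "k > 0" and "a > 0" and small: "2 * B / real k + (7 ^ k + 1) * a \<le> e"
    using drift_parameters[OF \<open>e > 0\<close>] .
  obtain \<delta>0 where "\<delta>0 > 0" and \<delta>0: "\<And>x y. x \<in> V \<Longrightarrow> y \<in> V \<Longrightarrow> d x y < \<delta>0 \<Longrightarrow> \<bar>f x - f y\<bar> \<le> a"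
    using f_cont[OF \<open>a > 0\<close>] by blast
  obtain N0 where N0: "\<forall>n\<ge>N0. \<forall>x\<in>V. \<bar>?u (Suc n) x - ?u n x\<bar> \<le> a"
    using increment_tendsto_0[OF u0 B \<open>a > 0\<close>] by blast
  \<comment> \<open>\<open>\<delta>0\<close> controls the variation of \<open>f\<close>;
    \<open>\<epsilon>\<close> makes the two points of a pair adjacent.\<close>
  define \<delta> where "\<delta> = min \<delta>0 \<epsilon>"
  have "\<delta> > 0" "\<delta> \<le> \<epsilon>"
    using \<open>\<delta>0 > 0\<close> \<open>\<epsilon> > 0\<close> by (auto simp: \<delta>_def)
  define Z where "Z = {(x, y). x \<in> V \<and> y \<in> V \<and> d x y < \<delta>}"
  \<comment> \<open>A neighbour \<open>y\<close> of \<open>x\<close> is closer than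
    \<open>\<epsilon> + \<delta>\<close> to \<open>x'\<close>, so the length space has a point
    \<open>y'\<close> adjacent to \<open>x'\<close> and within \<open>\<delta>\<close> of
    \<open>y\<close>.\<close>
  have couple: "\<exists>y'. (x', y') \<in> E \<and> d y' y < \<delta> \<and> y' \<in> V \<and> y \<in> V"
    if "x \<in> V" "x' \<in> V" "d x x' < \<delta>" "(x, y) \<in> E" for x x' y
  proof -
    have y: "y \<in> V" "d x y \<le> \<epsilon>"
      using \<open>(x, y) \<in> E\<close> by (auto simp: E_eq adjacency_edges_def)
    then have "d x' y < \<epsilon> + \<delta>"
      using triangle[of x' x y] that commute[of x x'] by linarith
    then obtain y' where "y' \<in> V" "d x' y' \<le> \<epsilon>" "d y' y < \<delta>"
      using compact_length_space_between[OF cls \<open>x' \<in> V\<close> y(1)] \<open>\<epsilon> > 0\<close> \<open>\<delta> > 0\<close>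
      by (metis less_imp_le)
    then show ?thesis
      using y \<open>x' \<in> V\<close> by (auto simp: E_eq adjacency_edges_def)
  qed
  have "\<exists>N. \<forall>n\<ge>N. \<forall>z\<in>Z. ?u n (fst z) - ?u n (snd z) \<le> 2 * B / k + (7 ^ k + 1) * a"
  proof (rule backward_drift[where \<phi> = "\<lambda>n z. - ?u n (fst z)" and C = "2 * B" and start = N0])
    fix n z assume "z \<in> Z"
    then show "\<bar>?u n (fst z) - ?u n (snd z)\<bar> \<le> 2 * B"
      using B[of "fst z" n] B[of "snd z" n] by (auto simp: Z_def)
  next
    fix L b :: real and n z
    assume "N0 \<le> n" and le: "\<forall>z\<in>Z. ?u n (fst z) - ?u n (snd z) \<le> L + a" and "a \<le> b" and "z \<in> Z"
      and ge: "L - b \<le> ?u (Suc n) (fst z) - ?u (Suc n) (snd z)"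
    obtain x x' where z: "z = (x, x')"
      by fastforce
    have x: "x \<in> V" "x' \<in> V" "d x x' < \<delta>" "d x' x < \<delta>"
      using \<open>z \<in> Z\<close> commute by (auto simp: Z_def z)
    have "f x - f x' \<le> a"
      using \<delta>0[of x x'] x by (simp add: \<delta>_def abs_le_iff)
    have "nbr_inf (?u n) x \<le> nbr_inf (?u n) x' + (L + a)"
    proof (rule nbr_inf_diff_le[OF u_bdd x(2)])
      fix y' assume "(x', y') \<in> E"
      then obtain y where y: "(x, y) \<in> E" "(y, y') \<in> Z"
        using couple[of x' x y'] x by (auto simp: Z_def)
      then show "\<exists>y. (x, y) \<in> E \<and> ?u n y \<le> ?u n y' + (L + a)"
        using bspec[OF le y(2)] by (intro exI[of _ y]) auto
    qed
    \<comment> \<open>The infima differ by at most \<open>L + a\<close> and the payoffs by at most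
      \<open>a\<close>, which leaves nearly \<open>L\<close> for the suprema.\<close>
    then have sup: "nbr_sup (?u n) x' + L - 2 * b - 3 * a \<le> nbr_sup (?u n) x"
      using ge \<open>f x - f x' \<le> a\<close>
      unfolding z fst_conv snd_conv game_value_Suc[of u0 n] by linarith
    obtain y where y: "(x, y) \<in> E" "nbr_sup (?u n) x - a < ?u n y"
      using nbr_sup_approx[OF x(1) \<open>a > 0\<close>] by metis
    then obtain y' where y': "(x', y') \<in> E" "d y' y < \<delta>" "y \<in> V" "y' \<in> V"
      using couple[of x x' y] x by auto
    have "?u n y' \<le> nbr_sup (?u n) x'"
      using le_nbr_sup[OF u_bdd y'(1)] .
    moreover have "(x', x) \<in> E"
      using x \<open>\<delta> \<le> \<epsilon>\<close> by (auto simp: E_eq adjacency_edges_def)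
    then have "?u n x \<le> nbr_sup (?u n) x'"
      by (rule le_nbr_sup[OF u_bdd])
    moreover have "\<bar>?u (Suc n) x - ?u n x\<bar> \<le> a"
      using N0 \<open>N0 \<le> n\<close> x by blast
    \<comment> \<open>The second inequality collects an error of \<open>2 * b + 5 * a\<close>, the
      origin of the factor \<open>7\<close>. Replacing the value at \<open>x\<close> by that of the
      next round costs one \<open>a\<close> and explains the start at \<open>N0\<close>.\<close>
    ultimately have "L - 7 * b \<le> ?u n y - ?u n y' \<and> - ?u n y \<le> - ?u (Suc n) x - L + 7 * b"
      using sup y(2) \<open>a \<le> b\<close> \<open>a > 0\<close> by linarith
    then show "\<exists>z'\<in>Z. L - 7 * b \<le> ?u n (fst z') - ?u n (snd z') \<and>
        - ?u n (fst z') \<le> - ?u (Suc n) (fst z) - L + 7 * b"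
      using y' commute[of y y'] by (intro bexI[of _ "(y, y')"]) (auto simp: Z_def z)
  qed (use B k \<open>a > 0\<close> in \<open>auto simp: Z_def\<close>)
  then obtain N where N: "\<And>n z. n \<ge> N \<Longrightarrow> z \<in> Z \<Longrightarrow> ?u n (fst z) - ?u n (snd z) \<le> e"
    using small by (meson order_trans)
  have "\<bar>?u n x - ?u n y\<bar> \<le> e" if "n \<ge> N" "x \<in> V" "y \<in> V" "d x y < \<delta>" for n x y
    using N[of n "(x, y)"] N[of n "(y, x)"] that commute[of x y] by (auto simp: Z_def abs_le_iff)
  with \<open>\<delta> > 0\<close> show ?thesis
    by blast
qed

section \<open>Conclusion for both kinds of graph\<close>

text \<open>The vanishing advantage supplies a uniform bound on the game values, so
  \<open>net\<close> is stated relative to any such bound. On the empty set convergence is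
  vacuous.\<close>

lemma uniformly_convergent_if_no_advantage:
  assumes u0: "bounded (u0 ` V)" and "long_term_advantage V E f = 0"
    and K: "\<And>x y. x \<in> V \<Longrightarrow> y \<in> V \<Longrightarrow> \<exists>k\<le>K. (x, y) \<in> E ^^ k"
    and net: "\<And>B e. (\<And>n x. x \<in> V \<Longrightarrow> \<bar>game_value E f u0 n x\<bar> \<le> B) \<Longrightarrow> e > 0 \<Longrightarrow>
      \<exists>D N. finite D \<and> D \<subseteq> V \<and>
        (\<forall>x\<in>V. \<exists>y\<in>D. \<forall>n\<ge>N. \<bar>game_value E f u0 n x - game_value E f u0 n y\<bar> \<le> e)"
  shows "uniformly_convergent_on V (game_value E f u0)"
proof (cases "V = {}")
  case False
  then obtain B where B: "\<And>n x. x \<in> V \<Longrightarrow> \<bar>game_value E f u0 n x\<bar> \<le> B"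
    using long_term_advantage_bounded[OF False K u0] assms(2) by auto
  then show ?thesis
    using uniformly_convergent_game_value[OF u0 B net[OF B]] by blast
qed (simp add: uniformly_convergent_on_def uniform_limit_iff)

end

lemma uniformly_convergent_adjacency:
  assumes cls: "compact_length_space V d" and "\<epsilon> > 0" and E: "E = adjacency_edges V d \<epsilon>"
    and f: "continuous_map (Metric_space.mtopology V d) euclideanreal f"
    and u0: "continuous_map (Metric_space.mtopology V d) euclideanreal u0"
    and adv: "long_term_advantage V E f = 0"
  shows "uniformly_convergent_on V (game_value E f u0)"
proof -
  interpret Metric_space V d
    using cls by (simp add: compact_length_space_def)
  have compact: "compact_space mtopology"
    using cls by (simp add: compact_length_space_def)
  then have compactin: "compactin mtopology V"
    by (simp add: compact_space_def)
  have bdd: "bounded (h ` V)" if "continuous_map mtopology euclideanreal h" for h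
    using image_compactin[OF compactin that] by (simp add: compact_imp_bounded)
  interpret tug_of_war V E f
    using bdd[OF f] \<open>\<epsilon> > 0\<close> by unfold_locales (auto simp: E adjacency_edges_def)
  have "mbounded V"
    using compactin by (rule compactin_imp_mbounded)
  then obtain D where D: "\<And>x y. x \<in> V \<Longrightarrow> y \<in> V \<Longrightarrow> d x y \<le> D"
    by (auto simp: mbounded_alt)
  \<comment> \<open>Since distances are below \<open>k * \<epsilon>\<close>, \<open>Suc k\<close>
    edges suffice between any two vertices.\<close>
  obtain k :: nat where k: "D / \<epsilon> < k"
    using reals_Archimedean2 by blast
  show ?thesis
  proof (rule uniformly_convergent_if_no_advantage[where K = "Suc k"])
    fix x y assume "x \<in> V" "y \<in> V"
    moreover from this have "d x y < real (Suc k) * \<epsilon>"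
      using D[of x y] k \<open>\<epsilon> > 0\<close> by (simp add: field_simps)
    ultimately show "\<exists>k'\<le>Suc k. (x, y) \<in> E ^^ k'"
      unfolding E using adjacency_edges_relpow[OF cls \<open>\<epsilon> > 0\<close>] by blast
  next
    fix B e :: real
    assume B: "\<And>n x. x \<in> V \<Longrightarrow> \<bar>game_value E f u0 n x\<bar> \<le> B" and "e > 0"
    have f_cont: "\<exists>\<delta>>0. \<forall>x\<in>V. \<forall>y\<in>V. d x y < \<delta> \<longrightarrow> \<bar>f x - f y\<bar> \<le> c" if "c > 0" for c
    proof -
      \<comment> \<open>The Heine-Cantor theorem on the compact space.\<close>
      have "uniformly_continuous_map (metric (V, d)) euclidean_metric f"
        using continuous_eq_uniformly_continuous_map[of "metric (V, d)" euclidean_metric f] compact f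
        by (simp add: mtopology_of_def)
      then obtain \<delta> where "\<delta> > 0" "\<forall>x\<in>V. \<forall>y\<in>V. d y x < \<delta> \<longrightarrow> dist (f y) (f x) < c"
        using \<open>c > 0\<close> by (auto simp: uniformly_continuous_map_def)
      then show ?thesis
        by (intro exI[of _ \<delta>]) (simp add: dist_real_def less_imp_le)
    qed
    have "\<exists>\<delta>>0. \<exists>N. \<forall>n\<ge>N. \<forall>x\<in>V. \<forall>y\<in>V. d x y < \<delta> \<longrightarrow>
        \<bar>game_value E f u0 n x - game_value E f u0 n y\<bar> \<le> e"
      by (rule asymptotically_equicontinuous[OF cls \<open>\<epsilon> > 0\<close> E f_cont bdd[OF u0] B \<open>e > 0\<close>])
    then obtain \<delta> N where "\<delta> > 0" and N: "\<forall>n\<ge>N. \<forall>x\<in>V. \<forall>y\<in>V. d x y < \<delta> \<longrightarrow>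
        \<bar>game_value E f u0 n x - game_value E f u0 n y\<bar> \<le> e"
      by (elim exE conjE) (rule that)
    \<comment> \<open>Finitely many balls of radius \<open>\<delta>\<close> turn equicontinuity into
      the required net.\<close>
    have "mtotally_bounded V"
      using compactin by (rule compactin_imp_mtotally_bounded)
    then have "\<exists>D. finite D \<and> D \<subseteq> V \<and> V \<subseteq> (\<Union>x\<in>D. mball x \<delta>)"
      using \<open>\<delta> > 0\<close> by (simp add: mtotally_bounded_def)
    then obtain D where D: "finite D" "D \<subseteq> V" "V \<subseteq> (\<Union>x\<in>D. mball x \<delta>)"
      by (elim exE conjE) (rule that)
    have "\<exists>y\<in>D. \<forall>n\<ge>N. \<bar>game_value E f u0 n x - game_value E f u0 n y\<bar> \<le> e" if x: "x \<in> V" for x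
    proof -
      obtain y where "y \<in> D" "x \<in> mball y \<delta>"
        using D(3) x by auto
      then have "d x y < \<delta>" "y \<in> V"
        using D(2) by (auto simp: commute)
      with \<open>y \<in> D\<close> show ?thesis
        using N x by (intro bexI[of _ y]) auto
    qed
    with D show "\<exists>D N. finite D \<and> D \<subseteq> V \<and>
        (\<forall>x\<in>V. \<exists>y\<in>D. \<forall>n\<ge>N. \<bar>game_value E f u0 n x - game_value E f u0 n y\<bar> \<le> e)"
      by blast
  qed (use bdd[OF u0] adv in auto)
qed

text \<open>The whole vertex set serves as the net, and \<open>K\<close> is the largest of the path
  lengths chosen for the finitely many pairs of vertices.\<close>

lemma uniformly_convergent_finite_graph:
  assumes G: "finite_connected_graph_with_loops V E" and adv: "long_term_advantage V E f = 0"
  shows "uniformly_convergent_on V (game_value E f u0)"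
proof -
  have fin: "finite V"
    using G by (simp add: finite_connected_graph_with_loops_def)
  interpret tug_of_war V E f
    using G by unfold_locales
      (auto simp: finite_connected_graph_with_loops_def intro!: finite_imp_bounded)
  have "\<exists>k. p \<in> E ^^ k" if "p \<in> V \<times> V" for p
  proof -
    have "p \<in> E\<^sup>*"
      using G that by (auto simp: finite_connected_graph_with_loops_def)
    then show ?thesis
      by (rule rtrancl_imp_relpow)
  qed
  then obtain k where k: "\<And>p. p \<in> V \<times> V \<Longrightarrow> p \<in> E ^^ k p"
    by metis
  show ?thesis
  proof (rule uniformly_convergent_if_no_advantage[where K = "Max (k ` (V \<times> V))"])
    fix x y assume "x \<in> V" "y \<in> V"
    then show "\<exists>k'\<le>Max (k ` (V \<times> V)). (x, y) \<in> E ^^ k'"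
      using fin k[of "(x, y)"] by (intro exI[of _ "k (x, y)"]) auto
  next
    fix B e :: real assume "e > 0"
    then show "\<exists>D N. finite D \<and> D \<subseteq> V \<and>
        (\<forall>x\<in>V. \<exists>y\<in>D. \<forall>n\<ge>N. \<bar>game_value E f u0 n x - game_value E f u0 n y\<bar> \<le> e)"
      using fin by (intro exI[of _ V] exI[of _ 0]) force
  qed (use fin adv in \<open>simp_all add: finite_imp_bounded\<close>)
qed

theorem theorem1p7:
  fixes V :: "'a set" and E :: "('a \<times> 'a) set" and f u0 :: "'a \<Rightarrow> real"
  assumes "(\<exists>d \<epsilon>. compact_length_space V d \<and> \<epsilon> > 0 \<and> E = adjacency_edges V d \<epsilon> \<and>
              continuous_map (Metric_space.mtopology V d) euclideanreal f \<and>
              continuous_map (Metric_space.mtopology V d) euclideanreal u0) \<or>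
           finite_connected_graph_with_loops V E"
    and "long_term_advantage V E f = 0"
  shows "uniformly_convergent_on V (game_value E f u0)"
  using assms uniformly_convergent_adjacency uniformly_convergent_finite_graph by metis

end
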